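(* Consider the remote-estimation Markov decision process described in the context. The optimal policy $\pi^*$, if it exists (as a stationary deterministic policy attaining the minimum in the Bellman equation $\mathcal{L}^*+h(s)=\min_{a\in\{0,1\}}\{l(s,a)+\sum_{s'}P_{s,s'}(a)h(s')\}$), exhibits a switching structure: for each estimation error $(i,j)$, $i\ne j$, there is a threshold $\tau^*_{i,j}\in\{1,2,\dots\}\cup\{\infty\}$ such that for $s=(i,j,\delta)$, $$\pi^*(s)=\begin{cases}1,&\delta\ge\tau^*_{i,j},\\0,&\text{otherwise,}\end{cases}$$ and $\pi^*(s)=0$ for synced states $s=(i,i,0)$. Here $\tau^*_{i,j}=1$ means always transmitting in error $(i,j)$ and $\tau^*_{i,j}=\infty$ means never transmitting.
   Context: Model. A source $\{X_t\}_{t\ge1}$ is a homogeneous discrete-time Markov chain on $\mathcal{X}=\{1,\dots,M\}$ with irreducible transition matrix $Q=(Q_{i,j})$. Let $\mathcal{X}_{\rm ap}=\{i: Q_{i,i}>0\}$, $\mathcal{X}_{\rm p}=\mathcal{X}\setminus\mathcal{X}_{\rm ap}$; assume $\mathcal{X}_{\rm ap}\ne\emptyset$. At each time $t$ a sensor chooses $A_t\in\{0,1\}$ (1 = transmit). The channel is i.i.d. Bernoulli $H_t$ with $\Pr[H_t=1]=p_s$, $p_f=1-p_s$, independent of the source. The estimate evolves as $\hat X_{t+1}=X_t$ if $A_t=1,H_t=1$, else $\hat X_{t+1}=\hat X_t$. The AoCE is $\Delta_t=\Delta_{t-1}+1$ if $X_t\ne\hat X_t$ and $(X_t,\hat X_t)=(X_{t-1},\hat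 X_{t-1})$; $\Delta_t=1$ if $X_t\ne\hat X_t$ and $(X_t,\hat X_t)\ne(X_{t-1},\hat X_{t-1})$; $\Delta_t=0$ if $X_t=\hat X_t$. State $S_t=(X_t,\hat X_t,\Delta_t)$ with state space $\mathcal{S}=\{(i,i,0)\}\cup\{(i,j,\delta): i\ne j,i\in\mathcal{X}_{\rm ap},\delta\ge1\}\cup\{(i,j,1):i\ne j,i\in\mathcal{X}_{\rm p}\}$. Transition probabilities $P_{s,s'}(a)$: for $s=(i,j,\delta)$, $i\ne j$, under $a=0$: to $(i,j,\delta+1)$ w.p. $Q_{i,i}$, to $(j,j,0)$ w.p. $Q_{i,j}$, to $(k,j,1)$ w.p. $Q_{i,k}$ ($k\ne i,j$); under $a=1$: to $(i,i,0)$ w.p. $Q_{i,i}p_s$, to $(k,i,1)$ w.p. $Q_{i,k}p_s$ ($k\ne i$), to $(i,j,\delta+1)$ w.p. $Q_{i,i}p_f$, to $(j,j,0)$ w.p. $Q_{i,j}p_f$, to $(k,j,1)$ w.p. $Q_{i,k}p_f$ ($k\ne i,j$). For $s=(i,i,0)$ and any $a$: to $(i,i,0)$ w.p. $Q_{i,i}$, to $(k,i,1)$ w.p. $Q_{i,k}$ ($k\ne i$). Costs: constants $D_{i,j}>0$ for $i\ne j$ and non-negative, non-decreasing, possibly unbounded age functions $g_{i,j}$; $c(i,j,\delta)=D_{i,j}g_{i,j}(\delta)$ for $i\ne j$, $c(i,i,0)=0$; per-stage cost $l(s,a)=c(s)+\lambda\mathbb{1}\{a\ne0\}$ with $\lambda\ge0$.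 A policy chooses $A_t$ as a (possibly randomized) function of the history $(X_{1:t},\hat X_{1:t},A_{1:t-1})$; average cost $\mathcal{L}(\pi)=\limsup_{T\to\infty}\frac1T\sum_{t=1}^T\mathbb{E}^\pi[l(S_t,A_t)\mid S_1=s_1]$; a policy is optimal if it attains $\mathcal{L}^*=\inf_\pi\mathcal{L}(\pi)$. *)

theory Defs
  imports "HOL-Analysis.Analysis"
begin

text \<open>Remote-estimation MDP.  Source alphabet X = {1..M}; a state is a triple
  (X_t, hat X_t, Delta_t) of type nat * nat * nat; actions are bool (True = transmit, a = 1).\<close>

type_synonym rstate = "nat \<times> nat \<times> nat"

definition Xset :: "nat \<Rightarrow> nat set" where
  "Xset M = {1..M}"

definition Xap :: "nat \<Rightarrow> (nat \<Rightarrow> nat \<Rightarrow> real) \<Rightarrow> nat set" where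
  "Xap M Q = {i \<in> Xset M. Q i i > 0}"

definition Xp :: "nat \<Rightarrow> (nat \<Rightarrow> nat \<Rightarrow> real) \<Rightarrow> nat set" where
  "Xp M Q = Xset M - Xap M Q"

definition Sspace :: "nat \<Rightarrow> (nat \<Rightarrow> nat \<Rightarrow> real) \<Rightarrow> rstate set" where
  "Sspace M Q =
     {(i, i, 0) | i. i \<in> Xset M}
   \<union> {(i, j, d) | i j d. i \<noteq> j \<and> i \<in> Xap M Q \<and> j \<in> Xset M \<and> d \<ge> 1}
   \<union> {(i, j, 1) | i j. i \<noteq> j \<and> i \<in> Xp M Q \<and> j \<in> Xset M}"

text \<open>One step of the source starting from X_t = i when the estimate becomes i
  (synced state, or successful transmission): to (i,i,0) w.p. Q i i, to (k,i,1) w.p. Q i k.\<close>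
definition sync_step :: "(nat \<Rightarrow> nat \<Rightarrow> real) \<Rightarrow> nat \<Rightarrow> rstate \<Rightarrow> real" where
  "sync_step Q i s' = (case s' of (i', j', d') \<Rightarrow>
     if j' = i then (if i' = i \<and> d' = 0 then Q i i
                     else if i' \<noteq> i \<and> d' = 1 then Q i i' else 0)
     else 0)"

definition idle_step :: "(nat \<Rightarrow> nat \<Rightarrow> real) \<Rightarrow> nat \<Rightarrow> nat \<Rightarrow> nat \<Rightarrow> rstate \<Rightarrow> real" where
  "idle_step Q i j d s' = (case s' of (i', j', d') \<Rightarrow>
     if j' = j then (if i' = i \<and> d' = d + 1 then Q i i
                     else if i' = j \<and> d' = 0 then Q i j
                     else if i' \<noteq> i \<and> i' \<noteq> j \<and> d' = 1 then Q i i' else 0)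
     else 0)"

definition trans :: "(nat \<Rightarrow> nat \<Rightarrow> real) \<Rightarrow> real \<Rightarrow> rstate \<Rightarrow> rstate \<Rightarrow> bool \<Rightarrow> real" where
  "trans Q ps s s' a = (case s of (i, j, d) \<Rightarrow>
     if i = j then sync_step Q i s'
     else if a then ps * sync_step Q i s' + (1 - ps) * idle_step Q i j d s'
     else idle_step Q i j d s')"

definition cost :: "(nat \<Rightarrow> nat \<Rightarrow> real) \<Rightarrow> (nat \<Rightarrow> nat \<Rightarrow> nat \<Rightarrow> real) \<Rightarrow> rstate \<Rightarrow> real" where
  "cost D g s = (case s of (i, j, d) \<Rightarrow> if i = j then 0 else D i j * g i j d)"

definition stage_cost ::
  "(nat \<Rightarrow> nat \<Rightarrow> real) \<Rightarrow> (nat \<Rightarrow> nat \<Rightarrow> nat \<Rightarrow> real) \<Rightarrow> real \<Rightarrow> rstate \<Rightarrow> bool \<Rightarrow> real" where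
  "stage_cost D g lam s a = cost D g s + (if a then lam else 0)"

text \<open>General (history-dependent, randomized) policies: given the past (state, action) pairs
  and the current state, the probability of transmitting.  The history of states
  S_1..S_t is in bijection with (X_{1:t}, hat X_{1:t}).\<close>
type_synonym policy = "(rstate \<times> bool) list \<Rightarrow> rstate \<Rightarrow> real"

definition valid_policy :: "policy \<Rightarrow> bool" where
  "valid_policy \<pi> \<longleftrightarrow> (\<forall>hist s. 0 \<le> \<pi> hist s \<and> \<pi> hist s \<le> 1)"

definition act_prob :: "policy \<Rightarrow> (rstate \<times> bool) list \<Rightarrow> rstate \<Rightarrow> bool \<Rightarrow> real" where
  "act_prob \<pi> hist s a = (if a then \<pi> hist s else 1 - \<pi> hist s)"

text \<open>exp_cost ... pi T hist s = expected sum of the next T stage costs, given history hist and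
  current state s.  With hist = [] and s = s_1 this is sum_{t=1}^T E^pi[l(S_t,A_t) | S_1 = s_1].\<close>
primrec exp_cost ::
  "nat \<Rightarrow> (nat \<Rightarrow> nat \<Rightarrow> real) \<Rightarrow> real \<Rightarrow> (nat \<Rightarrow> nat \<Rightarrow> real) \<Rightarrow> (nat \<Rightarrow> nat \<Rightarrow> nat \<Rightarrow> real)
   \<Rightarrow> real \<Rightarrow> policy \<Rightarrow> nat \<Rightarrow> (rstate \<times> bool) list \<Rightarrow> rstate \<Rightarrow> real" where
  "exp_cost M Q ps D g lam \<pi> 0 hist s = 0"
| "exp_cost M Q ps D g lam \<pi> (Suc T) hist s =
     (\<Sum>a\<in>UNIV. act_prob \<pi> hist s a *
        (stage_cost D g lam s a +
         (\<Sum>\<^sub>\<infinity>s'\<in>Sspace M Q. trans Q ps s s' a * exp_cost M Q ps D g lam \<pi> T (hist @ [(s, a)]) s')))"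

definition avg_cost ::
  "nat \<Rightarrow> (nat \<Rightarrow> nat \<Rightarrow> real) \<Rightarrow> real \<Rightarrow> (nat \<Rightarrow> nat \<Rightarrow> real) \<Rightarrow> (nat \<Rightarrow> nat \<Rightarrow> nat \<Rightarrow> real)
   \<Rightarrow> real \<Rightarrow> policy \<Rightarrow> rstate \<Rightarrow> ereal" where
  "avg_cost M Q ps D g lam \<pi> s1 =
     limsup (\<lambda>T. ereal (exp_cost M Q ps D g lam \<pi> T [] s1 / real T))"

definition opt_cost ::
  "nat \<Rightarrow> (nat \<Rightarrow> nat \<Rightarrow> real) \<Rightarrow> real \<Rightarrow> (nat \<Rightarrow> nat \<Rightarrow> real) \<Rightarrow> (nat \<Rightarrow> nat \<Rightarrow> nat \<Rightarrow> real)
   \<Rightarrow> real \<Rightarrow> rstate \<Rightarrow> ereal" where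
  "opt_cost M Q ps D g lam s1 =
     (INF \<pi> \<in> {\<pi>. valid_policy \<pi>}. avg_cost M Q ps D g lam \<pi> s1)"

definition Qval ::
  "nat \<Rightarrow> (nat \<Rightarrow> nat \<Rightarrow> real) \<Rightarrow> real \<Rightarrow> (nat \<Rightarrow> nat \<Rightarrow> real) \<Rightarrow> (nat \<Rightarrow> nat \<Rightarrow> nat \<Rightarrow> real)
   \<Rightarrow> real \<Rightarrow> (rstate \<Rightarrow> real) \<Rightarrow> rstate \<Rightarrow> bool \<Rightarrow> real" where
  "Qval M Q ps D g lam h s a =
     stage_cost D g lam s a + (\<Sum>\<^sub>\<infinity>s'\<in>Sspace M Q. trans Q ps s s' a * h s')"

text \<open>The stationary deterministic policy attaining the minimum in the Bellman equation,
  ties broken in favour of not transmitting: transmit iff strictly better.\<close>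
definition opt_action ::
  "nat \<Rightarrow> (nat \<Rightarrow> nat \<Rightarrow> real) \<Rightarrow> real \<Rightarrow> (nat \<Rightarrow> nat \<Rightarrow> real) \<Rightarrow> (nat \<Rightarrow> nat \<Rightarrow> nat \<Rightarrow> real)
   \<Rightarrow> real \<Rightarrow> (rstate \<Rightarrow> real) \<Rightarrow> rstate \<Rightarrow> bool" where
  "opt_action M Q ps D g lam h s \<longleftrightarrow>
     Qval M Q ps D g lam h s True < Qval M Q ps D g lam h s False"

end

theory Submission
  imports Defs
begin

text \<open>Transmitting in a synced state only adds \<open>\<lambda>\<close> to the cost. For an error \<open>(i, j)\<close> with
  \<open>Q i i > 0\<close> write \<open>H \<delta> = h (i, j, \<delta>)\<close>. Along the ages \<open>\<delta> \<ge> 1\<close> the Bellman equation is the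
  scalar recursion \<open>L + H \<delta> = c \<delta> + min y (\<lambda> + p\<^sub>s S + (1 - p\<^sub>s) y)\<close> with
  \<open>y = Q i i * H (\<delta> + 1) + R\<close>, where the value \<open>S\<close> after a successful transmission and the value
  \<open>R\<close> of leaving the error do not depend on \<open>\<delta>\<close>. The right-hand side is nondecreasing and
  1-Lipschitz in \<open>H (\<delta> + 1)\<close> and the cost \<open>c\<close> is nondecreasing, so a descent \<open>H \<delta> > H (\<delta> + 1)\<close>
  would recur with at least the same size at every later age and drive \<open>H\<close> to \<open>-\<infinity>\<close>, against the
  lower bound on \<open>h\<close>. Hence \<open>H\<close> is nondecreasing, and so is the criterion \<open>\<lambda> + p\<^sub>s S < p\<^sub>s y\<close>
  for transmitting; the threshold is the least age satisfying it. If \<open>Q i i = 0\<close>, the only age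
  is 1.\<close>

lemma enat_threshold:
  fixes A :: "nat set" and P :: "nat \<Rightarrow> bool"
  assumes "A \<subseteq> {1..}"
    and upward_closed: "\<And>n m. n \<in> A \<Longrightarrow> m \<in> A \<Longrightarrow> n \<le> m \<Longrightarrow> P n \<Longrightarrow> P m"
  shows "\<exists>\<tau>::enat. 1 \<le> \<tau> \<and> (\<forall>d\<in>A. P d \<longleftrightarrow> \<tau> \<le> enat d)"
proof (cases "\<exists>d\<in>A. P d")
  case True
  define n where "n = (LEAST d. d \<in> A \<and> P d)"
  have n: "n \<in> A" "P n"
    using LeastI_ex[of "\<lambda>d. d \<in> A \<and> P d"] True unfolding n_def by auto
  have "P d \<longleftrightarrow> n \<le> d" if "d \<in> A" for d
    using that n upward_closed[of n d] Least_le[of "\<lambda>d. d \<in> A \<and> P d" d] unfolding n_def by auto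
  moreover have "1 \<le> enat n"
    using n(1) assms(1) by (auto simp: one_enat_def)
  ultimately show ?thesis by auto
next
  case False
  then show ?thesis by (intro exI[of _ \<infinity>]) auto
qed

lemma min_damped_diff_le:
  fixes p B x y :: real
  assumes "0 \<le> p" "p \<le> 1"
  shows "min x (B + (1 - p) * x) - min y (B + (1 - p) * y) \<le> max 0 (x - y)"
proof (cases "x \<le> y")
  case True
  then have "(1 - p) * x \<le> (1 - p) * y"
    using assms by (simp add: mult_left_mono)
  with True show ?thesis by linarith
next
  case False
  then have "(1 - p) * (x - y) \<le> x - y"
    using assms by (simp add: mult_left_le_one_le)
  with False show ?thesis by (simp add: algebra_simps)
qed

lemma incseq_of_bounded_below_recursion:
  fixes H c :: "nat \<Rightarrow> real" and \<psi> :: "real \<Rightarrow> real"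
  assumes recursion: "\<And>n. H n = c n + \<psi> (H (Suc n))"
    and "incseq c"
    and \<psi>: "\<And>x y. \<psi> x - \<psi> y \<le> max 0 (x - y)"
    and bounded: "\<And>n. K \<le> H n"
  shows "incseq H"
proof (rule incseq_SucI, rule ccontr)
  fix d
  assume "\<not> H d \<le> H (Suc d)"
  define gap where "gap = H d - H (Suc d)"
  have "0 < gap"
    using \<open>\<not> H d \<le> H (Suc d)\<close> by (simp add: gap_def)
  have descent: "gap \<le> H (d + k) - H (Suc (d + k))" for k
  proof (induction k)
    case 0
    then show ?case by (simp add: gap_def)
  next
    case (Suc k)
    let ?n = "d + k"
    have "H ?n - H (Suc ?n) \<le> \<psi> (H (Suc ?n)) - \<psi> (H (Suc (Suc ?n)))"
      using recursion[of ?n] recursion[of "Suc ?n"] incseq_SucD[OF \<open>incseq c\<close>, of ?n] by linarith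
    also have "\<dots> \<le> max 0 (H (Suc ?n) - H (Suc (Suc ?n)))"
      by (rule \<psi>)
    finally show ?case
      using Suc.IH \<open>0 < gap\<close> by simp
  qed
  have decay: "H (d + k) \<le> H d - real k * gap" for k
  proof (induction k)
    case (Suc k)
    then show ?case
      using descent[of k] by (simp add: algebra_simps)
  qed simp
  obtain k :: nat where "(H d - K) / gap < real k"
    using reals_Archimedean2 by blast
  then have "H d - real k * gap < K"
    using \<open>0 < gap\<close> by (simp add: divide_less_eq algebra_simps)
  then show False
    using decay[of k] bounded[of "d + k"] by linarith
qed

lemma Sspace_error_iff:
  assumes "i \<noteq> j"
  shows "(i, j, d) \<in> Sspace M Q \<longleftrightarrow>
    i \<in> Xset M \<and> j \<in> Xset M \<and> 1 \<le> d \<and> (i \<in> Xap M Q \<or> d = 1)"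
  using assms unfolding Sspace_def Xp_def Xap_def by auto

lemma summable_on_Sspace_bounded_age:
  fixes f :: "rstate \<Rightarrow> real"
  assumes "\<And>i j d. f (i, j, d) \<noteq> 0 \<Longrightarrow> d \<le> B"
  shows "f summable_on Sspace M Q"
proof -
  have "Sspace M Q \<subseteq> Xset M \<times> Xset M \<times> UNIV"
    unfolding Sspace_def Xap_def Xp_def by auto
  then have "{s \<in> Sspace M Q. f s \<noteq> 0} \<subseteq> Xset M \<times> Xset M \<times> {..B}"
    using assms by fastforce
  then have "finite {s \<in> Sspace M Q. f s \<noteq> 0}"
    by (rule finite_subset) (simp add: Xset_def)
  then have "f summable_on {s \<in> Sspace M Q. f s \<noteq> 0}"
    by simp
  moreover have "f summable_on {s \<in> Sspace M Q. f s \<noteq> 0} \<longleftrightarrow> f summable_on Sspace M Q"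
    by (rule summable_on_cong_neutral) auto
  ultimately show ?thesis by simp
qed

lemma infsum_single_point:
  fixes c :: "'b::{comm_monoid_add, t2_space}"
  assumes "a \<in> A"
  shows "(\<Sum>\<^sub>\<infinity>x\<in>A. if x = a then c else 0) = c"
proof -
  have "(\<Sum>\<^sub>\<infinity>x\<in>A. if x = a then c else 0) = (\<Sum>\<^sub>\<infinity>x\<in>{a}. if x = a then c else 0)"
    by (rule infsum_cong_neutral) (use assms in auto)
  then show ?thesis by simp
qed

definition idle_exit :: "(nat \<Rightarrow> nat \<Rightarrow> real) \<Rightarrow> nat \<Rightarrow> nat \<Rightarrow> rstate \<Rightarrow> real" where
  "idle_exit Q i j s' = (case s' of (i', j', d') \<Rightarrow>
     if j' = j then (if i' = j \<and> d' = 0 then Q i j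
                     else if i' \<noteq> i \<and> i' \<noteq> j \<and> d' = 1 then Q i i' else 0)
     else 0)"

lemma idle_step_split:
  assumes "i \<noteq> j"
  shows "idle_step Q i j d s' = (if s' = (i, j, Suc d) then Q i i else 0) + idle_exit Q i j s'"
  using assms unfolding idle_step_def idle_exit_def by (auto split: prod.splits)

lemma summable_on_sync_step: "(\<lambda>s'. sync_step Q i s' * h s') summable_on Sspace M Q"
  by (rule summable_on_Sspace_bounded_age[where B = 1]) (auto simp: sync_step_def split: if_splits)

lemma summable_on_idle_step: "(\<lambda>s'. idle_step Q i j d s' * h s') summable_on Sspace M Q"
  by (rule summable_on_Sspace_bounded_age[where B = "Suc d"]) (auto simp: idle_step_def split: if_splits)

lemma summable_on_idle_exit: "(\<lambda>s'. idle_exit Q i j s' * h s') summable_on Sspace M Q"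
  by (rule summable_on_Sspace_bounded_age[where B = 1]) (auto simp: idle_exit_def split: if_splits)

lemma infsum_idle_step:
  fixes h :: "rstate \<Rightarrow> real"
  assumes "i \<noteq> j" "(i, j, Suc d) \<in> Sspace M Q"
  shows "(\<Sum>\<^sub>\<infinity>s'\<in>Sspace M Q. idle_step Q i j d s' * h s')
       = Q i i * h (i, j, Suc d) + (\<Sum>\<^sub>\<infinity>s'\<in>Sspace M Q. idle_exit Q i j s' * h s')"
proof -
  let ?stay = "\<lambda>s'. if s' = (i, j, Suc d) then Q i i * h (i, j, Suc d) else 0"
  have "(\<Sum>\<^sub>\<infinity>s'\<in>Sspace M Q. idle_step Q i j d s' * h s')
      = (\<Sum>\<^sub>\<infinity>s'\<in>Sspace M Q. ?stay s' + idle_exit Q i j s' * h s')"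
    by (rule infsum_cong) (simp add: idle_step_split[OF assms(1)] algebra_simps)
  also have "\<dots> = (\<Sum>\<^sub>\<infinity>s'\<in>Sspace M Q. ?stay s') + (\<Sum>\<^sub>\<infinity>s'\<in>Sspace M Q. idle_exit Q i j s' * h s')"
    by (intro infsum_add summable_on_idle_exit summable_on_Sspace_bounded_age[where B = "Suc d"])
      (auto split: if_splits)
  finally show ?thesis
    using infsum_single_point[OF assms(2)] by simp
qed

definition sync_value :: "nat \<Rightarrow> (nat \<Rightarrow> nat \<Rightarrow> real) \<Rightarrow> (rstate \<Rightarrow> real) \<Rightarrow> nat \<Rightarrow> real" where
  "sync_value M Q h i = (\<Sum>\<^sub>\<infinity>s'\<in>Sspace M Q. sync_step Q i s' * h s')"

definition exit_value ::
  "nat \<Rightarrow> (nat \<Rightarrow> nat \<Rightarrow> real) \<Rightarrow> (rstate \<Rightarrow> real) \<Rightarrow> nat \<Rightarrow> nat \<Rightarrow> real" where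
  "exit_value M Q h i j = (\<Sum>\<^sub>\<infinity>s'\<in>Sspace M Q. idle_exit Q i j s' * h s')"

lemma Qval_error_state:
  fixes h :: "rstate \<Rightarrow> real"
  assumes "i \<noteq> j" "(i, j, Suc d) \<in> Sspace M Q"
  shows "Qval M Q ps D g lam h (i, j, d) False
       = cost D g (i, j, d) + (Q i i * h (i, j, Suc d) + exit_value M Q h i j)"
    and "Qval M Q ps D g lam h (i, j, d) True
       = cost D g (i, j, d) + lam + ps * sync_value M Q h i
         + (1 - ps) * (Q i i * h (i, j, Suc d) + exit_value M Q h i j)"
proof -
  have idle: "(\<Sum>\<^sub>\<infinity>s'\<in>Sspace M Q. idle_step Q i j d s' * h s')
      = Q i i * h (i, j, Suc d) + exit_value M Q h i j"
    unfolding exit_value_def by (rule infsum_idle_step[OF assms])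
  have "(\<Sum>\<^sub>\<infinity>s'\<in>Sspace M Q. trans Q ps (i, j, d) s' False * h s')
      = (\<Sum>\<^sub>\<infinity>s'\<in>Sspace M Q. idle_step Q i j d s' * h s')"
    by (rule infsum_cong) (simp add: trans_def assms(1))
  then show "Qval M Q ps D g lam h (i, j, d) False
      = cost D g (i, j, d) + (Q i i * h (i, j, Suc d) + exit_value M Q h i j)"
    unfolding Qval_def stage_cost_def idle by simp
  have "(\<Sum>\<^sub>\<infinity>s'\<in>Sspace M Q. trans Q ps (i, j, d) s' True * h s')
      = (\<Sum>\<^sub>\<infinity>s'\<in>Sspace M Q. ps * (sync_step Q i s' * h s') + (1 - ps) * (idle_step Q i j d s' * h s'))"
    by (rule infsum_cong) (simp add: trans_def assms(1) algebra_simps)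
  also have "\<dots> = ps * sync_value M Q h i + (1 - ps) * (\<Sum>\<^sub>\<infinity>s'\<in>Sspace M Q. idle_step Q i j d s' * h s')"
    unfolding sync_value_def
    by (simp add: infsum_add summable_on_cmult_right summable_on_sync_step summable_on_idle_step
        infsum_cmult_right')
  finally show "Qval M Q ps D g lam h (i, j, d) True
      = cost D g (i, j, d) + lam + ps * sync_value M Q h i
        + (1 - ps) * (Q i i * h (i, j, Suc d) + exit_value M Q h i j)"
    unfolding Qval_def stage_cost_def idle by simp
qed

lemma opt_action_error_state_iff:
  assumes "i \<noteq> j" "(i, j, Suc d) \<in> Sspace M Q"
  shows "opt_action M Q ps D g lam h (i, j, d) \<longleftrightarrow>
    lam + ps * sync_value M Q h i < ps * (Q i i * h (i, j, Suc d) + exit_value M Q h i j)"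
  unfolding opt_action_def Qval_error_state[OF assms] by (simp add: algebra_simps)

lemma not_opt_action_synced:
  assumes "0 \<le> lam"
  shows "\<not> opt_action M Q ps D g lam h (i, i, 0)"
  using assms unfolding opt_action_def Qval_def stage_cost_def trans_def by simp

locale bellman_solution =
  fixes M :: nat and Q :: "nat \<Rightarrow> nat \<Rightarrow> real" and ps lam L :: real
    and D :: "nat \<Rightarrow> nat \<Rightarrow> real" and g :: "nat \<Rightarrow> nat \<Rightarrow> nat \<Rightarrow> real"
    and h :: "rstate \<Rightarrow> real"
  assumes Q_nonneg: "\<forall>i\<in>Xset M. \<forall>j\<in>Xset M. 0 \<le> Q i j"
    and Q_stoch: "\<forall>i\<in>Xset M. (\<Sum>j\<in>Xset M. Q i j) = 1"
    and ps_range: "0 \<le> ps" "ps \<le> 1"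
    and D_nonneg: "\<forall>i\<in>Xset M. \<forall>j\<in>Xset M. i \<noteq> j \<longrightarrow> 0 \<le> D i j"
    and g_mono: "\<forall>i\<in>Xset M. \<forall>j\<in>Xset M. i \<noteq> j \<longrightarrow>
                   (\<forall>d d'. 1 \<le> d \<longrightarrow> d \<le> d' \<longrightarrow> g i j d \<le> g i j d')"
    and bellman: "\<forall>s\<in>Sspace M Q.
                    L + h s = min (Qval M Q ps D g lam h s False) (Qval M Q ps D g lam h s True)"
    and h_bdd_below: "\<exists>K. \<forall>s\<in>Sspace M Q. K \<le> h s"
begin

lemma Q_le_one:
  assumes "i \<in> Xset M" "j \<in> Xset M"
  shows "Q i j \<le> 1"
proof -
  have "Q i j \<le> (\<Sum>k\<in>Xset M. Q i k)"
    by (rule member_le_sum) (use assms Q_nonneg in \<open>auto simp: Xset_def\<close>)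
  then show ?thesis
    using Q_stoch assms(1) by simp
qed

lemma h_age_mono:
  assumes "i \<in> Xap M Q" "j \<in> Xset M" "i \<noteq> j"
  shows "incseq (\<lambda>n. h (i, j, Suc n))"
proof -
  define q where "q = Q i i"
  define S where "S = sync_value M Q h i"
  define R where "R = exit_value M Q h i j"
  define \<psi> where "\<psi> x = min (q * x + R) (lam + ps * S + (1 - ps) * (q * x + R))" for x
  have i: "i \<in> Xset M" "0 < q"
    using assms(1) by (auto simp: Xap_def q_def)
  have state: "(i, j, Suc n) \<in> Sspace M Q" for n
    using assms by (simp add: Sspace_error_iff i)
  have recursion: "h (i, j, Suc n) = (cost D g (i, j, Suc n) - L) + \<psi> (h (i, j, Suc (Suc n)))" for n
    using bellman state[of n] Qval_error_state[OF assms(3) state[of "Suc n"]]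
    unfolding \<psi>_def q_def S_def R_def by (auto simp: min_def)
  have "incseq (\<lambda>n. cost D g (i, j, Suc n) - L)"
  proof (rule incseq_SucI)
    fix n
    have "g i j (Suc n) \<le> g i j (Suc (Suc n))"
      using g_mono assms i by auto
    then show "cost D g (i, j, Suc n) - L \<le> cost D g (i, j, Suc (Suc n)) - L"
      using D_nonneg assms i by (simp add: cost_def mult_left_mono)
  qed
  moreover have "\<psi> x - \<psi> y \<le> max 0 (x - y)" for x y
  proof -
    have "\<psi> x - \<psi> y \<le> max 0 (q * (x - y))"
      using min_damped_diff_le[OF ps_range, of "q * x + R" "lam + ps * S" "q * y + R"]
      by (simp add: \<psi>_def algebra_simps)
    also have "\<dots> \<le> max 0 (x - y)"
      using i(2) Q_le_one[OF i(1) i(1)] unfolding q_def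
      by (cases "0 \<le> x - y") (auto simp: mult_left_le_one_le mult_pos_neg)
    finally show ?thesis .
  qed
  moreover obtain K where "K \<le> h (i, j, Suc n)" for n
    using h_bdd_below state by blast
  ultimately show ?thesis
    by (rule incseq_of_bounded_below_recursion[where H = "\<lambda>n. h (i, j, Suc n)", OF recursion])
qed

lemma opt_action_age_mono:
  assumes "i \<noteq> j" "(i, j, n) \<in> Sspace M Q" "(i, j, m) \<in> Sspace M Q" "n \<le> m"
    and "opt_action M Q ps D g lam h (i, j, n)"
  shows "opt_action M Q ps D g lam h (i, j, m)"
proof (cases "i \<in> Xap M Q")
  case False
  then show ?thesis
    using assms by (simp add: Sspace_error_iff False)
next
  case True
  have j: "j \<in> Xset M"
    using assms(2) by (simp add: Sspace_error_iff[OF assms(1)])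
  have criterion: "opt_action M Q ps D g lam h (i, j, d) \<longleftrightarrow>
      lam + ps * sync_value M Q h i < ps * (Q i i * h (i, j, Suc d) + exit_value M Q h i j)" for d
    using True j assms(1) by (simp add: opt_action_error_state_iff Sspace_error_iff Xap_def)
  have "h (i, j, Suc n) \<le> h (i, j, Suc m)"
    using h_age_mono[OF True j assms(1)] assms(4) by (simp add: incseq_def)
  then have "ps * (Q i i * h (i, j, Suc n) + exit_value M Q h i j)
      \<le> ps * (Q i i * h (i, j, Suc m) + exit_value M Q h i j)"
    using True ps_range by (simp add: Xap_def mult_left_mono)
  then show ?thesis
    using assms(5) unfolding criterion by linarith
qed

end

theorem theorem2:
  fixes M :: nat and Q :: "nat \<Rightarrow> nat \<Rightarrow> real" and ps lam L :: real
    and D :: "nat \<Rightarrow> nat \<Rightarrow> real" and g :: "nat \<Rightarrow> nat \<Rightarrow> nat \<Rightarrow> real"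
    and h :: "rstate \<Rightarrow> real"
  assumes Q_nonneg: "\<forall>i\<in>Xset M. \<forall>j\<in>Xset M. 0 \<le> Q i j"
    and Q_stoch: "\<forall>i\<in>Xset M. (\<Sum>j\<in>Xset M. Q i j) = 1"
    and Q_irred: "\<forall>i\<in>Xset M. \<forall>j\<in>Xset M.
                    (i, j) \<in> {(a, b). a \<in> Xset M \<and> b \<in> Xset M \<and> 0 < Q a b}\<^sup>*"
    and Xap_ne: "Xap M Q \<noteq> {}"
    and ps_range: "0 \<le> ps" "ps \<le> 1"
    and D_pos: "\<forall>i\<in>Xset M. \<forall>j\<in>Xset M. i \<noteq> j \<longrightarrow> 0 < D i j"
    and g_nonneg: "\<forall>i\<in>Xset M. \<forall>j\<in>Xset M. i \<noteq> j \<longrightarrow> (\<forall>d\<ge>1. 0 \<le> g i j d)"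
    and g_mono: "\<forall>i\<in>Xset M. \<forall>j\<in>Xset M. i \<noteq> j \<longrightarrow>
                   (\<forall>d d'. 1 \<le> d \<longrightarrow> d \<le> d' \<longrightarrow> g i j d \<le> g i j d')"
    and lam_nonneg: "0 \<le> lam"
    and L_opt: "\<forall>s1\<in>Sspace M Q. opt_cost M Q ps D g lam s1 = ereal L"
    and bellman: "\<forall>s\<in>Sspace M Q.
                    L + h s = min (Qval M Q ps D g lam h s False) (Qval M Q ps D g lam h s True)"
    and h_bdd_below: "\<exists>K. \<forall>s\<in>Sspace M Q. K \<le> h s"
  shows "(\<forall>i\<in>Xset M. \<not> opt_action M Q ps D g lam h (i, i, 0)) \<and>
         (\<forall>i\<in>Xset M. \<forall>j\<in>Xset M. i \<noteq> j \<longrightarrow>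
            (\<exists>\<tau>::enat. 1 \<le> \<tau> \<and>
               (\<forall>d. (i, j, d) \<in> Sspace M Q \<longrightarrow>
                    (opt_action M Q ps D g lam h (i, j, d) \<longleftrightarrow> \<tau> \<le> enat d))))"
proof -
  interpret bellman_solution M Q ps lam L D g h
    using Q_nonneg Q_stoch ps_range D_pos g_mono bellman h_bdd_below
    by unfold_locales (auto simp: less_imp_le)
  have "\<exists>\<tau>::enat. 1 \<le> \<tau> \<and> (\<forall>d\<in>{d. (i, j, d) \<in> Sspace M Q}.
          opt_action M Q ps D g lam h (i, j, d) \<longleftrightarrow> \<tau> \<le> enat d)" if "i \<noteq> j" for i j
  proof (rule enat_threshold)
    show "{d. (i, j, d) \<in> Sspace M Q} \<subseteq> {1..}"
      by (auto simp: Sspace_error_iff[OF that])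
  qed (auto intro: opt_action_age_mono[OF that])
  then show ?thesis
    using not_opt_action_synced[OF lam_nonneg] by auto
qed

end
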